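(* Let $x$ be a real number and $n$ a positive integer. Then $$\prod_{r=1}^{n}\left(\epsilon_1^{r-1}+x\,\epsilon_2^{r-1}\right)=\sum_{\kappa=0}^{n}\epsilon_1^{\binom{n-\kappa}{2}}\,\epsilon_2^{\binom{\kappa}{2}}\begin{bmatrix} n\\ \kappa\end{bmatrix}x^{\kappa}.$$
   Context: Let $0<q<p\le 1$ be real numbers and let $\mathcal{R}$ be a meromorphic function of two variables. For real $u$ the $\mathcal{R}(p,q)$-deformed number is $[u]:=\mathcal{R}(p^u,q^u)$. Standing assumption: there are positive real numbers $\epsilon_1=\Phi_1(p,q)$, $\epsilon_2=\Phi_2(p,q)$ such that for all real $u,v$, $$[u+v]=\epsilon_1^{v}[u]+\epsilon_2^{u}[v],$$ and $[k]\neq0$ for every integer $k\ge1$. Define, for real $u$ and integer $\kappa\ge1$, the deformed factorial of $u$ of order $\kappa$ by $[u]_{\kappa}:=\prod_{v=1}^{\kappa}[u-v+1]$, with $[u]_0:=1$; the factorial $[k]!:=[1][2]\cdots[k]$, $[0]!:=1$; and the deformed binomial coefficient $\begin{bmatrix}u\\ \kappa\end{bmatrix}:=[u]_\kappa/[\kappa]!$ (all with respect to $\mathcal{R}(p,q)$). *)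

theory Defs
  imports "HOL-Analysis.Analysis"
begin

text \<open>
  Complex (Frechet) differentiability on an open subset of \<open>\<complex>\<^sup>2\<close>: the derivative is required to be
  complex linear, \<open>(h, k) \<mapsto> a h + b k\<close>.
\<close>

definition holomorphic2_on :: "(complex \<times> complex \<Rightarrow> complex) \<Rightarrow> (complex \<times> complex) set \<Rightarrow> bool"
    (infixl "holomorphic2'_on" 50) where
  "f holomorphic2_on U \<longleftrightarrow>
     open U \<and> (\<forall>z\<in>U. \<exists>a b. (f has_derivative (\<lambda>(h, k). a * h + b * k)) (at z))"

text \<open>
  A function of two complex variables is meromorphic on an open set if it is locally a quotient
  of holomorphic functions with a denominator that does not vanish identically. As for the
  library's one-variable \<open>meromorphic_on\<close>, the values at singular points are unconstrained.
  Connectedness of the neighbourhood ensures that the zero set of the denominator is nowhere dense.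
\<close>

definition meromorphic2_on :: "(complex \<times> complex \<Rightarrow> complex) \<Rightarrow> (complex \<times> complex) set \<Rightarrow> bool"
    (infixl "meromorphic2'_on" 50) where
  "f meromorphic2_on D \<longleftrightarrow> open D \<and>
     (\<forall>z\<in>D. \<exists>U g h. z \<in> U \<and> U \<subseteq> D \<and> open U \<and> connected U \<and>
        g holomorphic2_on U \<and> h holomorphic2_on U \<and> (\<exists>w\<in>U. h w \<noteq> 0) \<and>
        (\<forall>w\<in>U. h w \<noteq> 0 \<longrightarrow> f w = g w / h w))"

definition deformed_number ::
    "(complex \<times> complex \<Rightarrow> complex) \<Rightarrow> real \<Rightarrow> real \<Rightarrow> real \<Rightarrow> complex" where
  "deformed_number R p q u = R (of_real (p powr u), of_real (q powr u))"

text \<open>The deformed factorial of the real number \<open>u\<close> of order \<open>k\<close>.\<close>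

definition deformed_ffact ::
    "(complex \<times> complex \<Rightarrow> complex) \<Rightarrow> real \<Rightarrow> real \<Rightarrow> real \<Rightarrow> nat \<Rightarrow> complex" where
  "deformed_ffact R p q u k = (\<Prod>v=1..k. deformed_number R p q (u - real v + 1))"

definition deformed_fact ::
    "(complex \<times> complex \<Rightarrow> complex) \<Rightarrow> real \<Rightarrow> real \<Rightarrow> nat \<Rightarrow> complex" where
  "deformed_fact R p q k = (\<Prod>j=1..k. deformed_number R p q (real j))"

definition deformed_binomial ::
    "(complex \<times> complex \<Rightarrow> complex) \<Rightarrow> real \<Rightarrow> real \<Rightarrow> real \<Rightarrow> nat \<Rightarrow> complex" where
  "deformed_binomial R p q u k = deformed_ffact R p q u k / deformed_fact R p q k"

end

theory Submission imports Defs begin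

text \<open>
  Induction on \<open>n\<close>. Splitting \<open>n + 1 = (n - k) + (k + 1)\<close> in the addition rule for \<open>[n + 1]\<close> gives
  the Pascal rule
  \<open>\<epsilon>\<^sub>1^(k+1) [n, k+1] + \<epsilon>\<^sub>2^(n-k) [n, k] = [n+1, k+1]\<close> for the deformed binomial coefficients.
  Together with \<open>(m + 1) choose 2 = (m choose 2) + m\<close> it shows that the coefficients of the sum
  satisfy the recurrence given by multiplication with \<open>\<epsilon>\<^sub>1^n + x \<epsilon>\<^sub>2^n\<close>.
\<close>

text \<open>Writing the factor index as \<open>n + 1 - v\<close> instead of \<open>n - v + 1\<close>
  keeps truncated subtraction exact up to \<open>v = n + 1\<close>, where the factor is
  \<open>N 0\<close>.\<close>

definition seq_binomial :: "(nat \<Rightarrow> 'a::field) \<Rightarrow> nat \<Rightarrow> nat \<Rightarrow> 'a" where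
  "seq_binomial N n k = (\<Prod>v=1..k. N (n + 1 - v)) / (\<Prod>j=1..k. N j)"

lemma seq_binomial_0 [simp]: "seq_binomial N n 0 = 1"
  by (simp add: seq_binomial_def)

lemma seq_binomial_Suc: "seq_binomial N n (Suc k) = seq_binomial N n k * N (n - k) / N (Suc k)"
  by (simp add: seq_binomial_def)

text \<open>Absorption: here the first factor of the numerator is split off and the others are
  reindexed, whereas \<open>seq_binomial_Suc\<close> splits off the last one.\<close>

lemma Suc_times_seq_binomial:
  "seq_binomial N (Suc n) (Suc k) = N (Suc n) * seq_binomial N n k / N (Suc k)"
proof -
  have "(\<Prod>v=1..Suc k. N (Suc n + 1 - v)) = N (Suc n) * (\<Prod>v=1..k. N (n + 1 - v))"
    using prod.shift_bounds_cl_Suc_ivl[of "\<lambda>v. N (Suc n + 1 - v)" 1 k]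
      prod.atLeast_Suc_atMost[of 1 "Suc k" "\<lambda>v. N (Suc n + 1 - v)"]
    by simp
  then show ?thesis
    by (simp add: seq_binomial_def)
qed

lemma choose_two_Suc: "Suc m choose 2 = (m choose 2) + m"
  by (simp add: numeral_2_eq_2)

text \<open>At natural arguments the real powers in the addition rule become ordinary powers, so the
  identity turns into pure algebra over any field.\<close>

locale deformed_sequence =
  fixes N :: "nat \<Rightarrow> 'a::field" and a b :: 'a
  assumes add: "N (i + j) = a ^ j * N i + b ^ i * N j"
    and nonzero: "k \<ge> 1 \<Longrightarrow> N k \<noteq> 0"
begin

lemma at_0: "N 0 = 0"
proof -
  have "N 0 + N 0 = N 0 + 0"
    using add[of 0 0] by simp
  then show ?thesis
    by (simp only: add_left_cancel)
qed

text \<open>The last factor of the numerator is \<open>N (n - n) = N 0\<close>.\<close>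

lemma seq_binomial_eq_0: "seq_binomial N n (Suc n) = 0"
  by (simp add: seq_binomial_Suc at_0)

text \<open>All three coefficients are multiples of \<open>seq_binomial N n k / N (Suc k)\<close>;
  cancelling this common factor leaves the addition rule.\<close>

lemma seq_binomial_Pascal:
  assumes "k \<le> n"
  shows "seq_binomial N (Suc n) (Suc k) =
    a ^ Suc k * seq_binomial N n (Suc k) + b ^ (n - k) * seq_binomial N n k"
proof -
  have "N (Suc n) = a ^ Suc k * N (n - k) + b ^ (n - k) * N (Suc k)"
    using add[of "n - k" "Suc k"] assms by simp
  then show ?thesis
    using nonzero[of "Suc k"]
    by (simp add: Suc_times_seq_binomial seq_binomial_Suc[of N n k] field_simps)
qed

theorem prod_eq_sum_seq_binomial:
  "(\<Prod>r=1..n. a ^ (r - 1) + x * b ^ (r - 1)) =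
   (\<Sum>k=0..n. a ^ ((n - k) choose 2) * b ^ (k choose 2) * seq_binomial N n k * x ^ k)"
proof (induction n)
  case 0
  then show ?case by (simp add: numeral_2_eq_2)
next
  case (Suc n)
  define T where "T m k = a ^ ((m - k) choose 2) * b ^ (k choose 2) * seq_binomial N m k * x ^ k"
    for m k
  have T_0: "T (Suc n) 0 = a ^ n * T n 0"
    by (simp add: T_def choose_two_Suc power_add)
  have T_Suc: "T (Suc n) (Suc k) = a ^ n * T n (Suc k) + x * b ^ n * T n k" if "k \<le> n" for k
  proof -
    \<comment> \<open>For \<open>k < n\<close> both exponents of \<open>a\<close> agree, by
      \<open>choose_two_Suc\<close> at \<open>n - Suc k\<close>. For \<open>k = n\<close> they
      differ, but the coefficient vanishes.\<close>
    have a: "a ^ ((n - k) choose 2) * a ^ Suc k * seq_binomial N n (Suc k) =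
        a ^ n * a ^ ((n - Suc k) choose 2) * seq_binomial N n (Suc k)"
    proof (cases "k = n")
      case True
      then show ?thesis by (simp add: seq_binomial_eq_0)
    next
      case False
      with that obtain d where "n = Suc (k + d)"
        by (metis le_neq_implies_less less_iff_Suc_add)
      then show ?thesis
        by (simp add: choose_two_Suc power_add mult_ac)
    qed
    have "b ^ k * b ^ (n - k) = b ^ n"
      using that by (simp flip: power_add)
    then have b: "b ^ (Suc k choose 2) * b ^ (n - k) = b ^ n * b ^ (k choose 2)"
      by (simp add: choose_two_Suc power_add mult.assoc mult.commute)
    have "T (Suc n) (Suc k) =
        (a ^ ((n - k) choose 2) * a ^ Suc k * seq_binomial N n (Suc k)) *
          b ^ (Suc k choose 2) * x ^ Suc k +
        (b ^ (Suc k choose 2) * b ^ (n - k)) *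
          a ^ ((n - k) choose 2) * seq_binomial N n k * x ^ Suc k"
      by (simp add: T_def seq_binomial_Pascal[OF that] algebra_simps)
    also have "\<dots> = a ^ n * T n (Suc k) + x * b ^ n * T n k"
      unfolding a b by (simp add: T_def algebra_simps)
    finally show ?thesis .
  qed
  have T_top: "T n (Suc n) = 0"
    by (simp add: T_def seq_binomial_eq_0)
  \<comment> \<open>Index 0 is split off because the recurrence \<open>T_Suc\<close> covers
    successor indices only.\<close>
  have "(\<Sum>k=0..Suc n. T (Suc n) k) = T (Suc n) 0 + (\<Sum>k=0..n. T (Suc n) (Suc k))"
    by (rule sum.atLeast0_atMost_Suc_shift[unfolded comp_def])
  also have "\<dots> = a ^ n * (T n 0 + (\<Sum>k=0..n. T n (Suc k))) + x * b ^ n * (\<Sum>k=0..n. T n k)"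
    by (simp add: T_0 T_Suc sum.distrib sum_distrib_left algebra_simps)
  \<comment> \<open>Undoing the shift yields a sum up to \<open>Suc n\<close>, whose extra last term
    is zero by \<open>T_top\<close>.\<close>
  also have "T n 0 + (\<Sum>k=0..n. T n (Suc k)) = (\<Sum>k=0..Suc n. T n k)"
    by (rule sum.atLeast0_atMost_Suc_shift[unfolded comp_def, symmetric])
  also have "\<dots> = (\<Sum>k=0..n. T n k)"
    by (simp add: T_top)
  finally have "(\<Sum>k=0..Suc n. T (Suc n) k) = (\<Sum>k=0..n. T n k) * (a ^ n + x * b ^ n)"
    by (simp add: algebra_simps)
  with Suc.IH show ?case
    by (simp add: T_def)
qed

end

lemma deformed_binomial_of_nat:
  assumes "k \<le> n"
  shows "deformed_binomial R p q (real n) k =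
    seq_binomial (\<lambda>m. deformed_number R p q (real m)) n k"
proof -
  have "deformed_ffact R p q (real n) k = (\<Prod>v=1..k. deformed_number R p q (real (n + 1 - v)))"
    unfolding deformed_ffact_def
  proof (rule prod.cong)
    fix v assume "v \<in> {1..k}"
    \<comment> \<open>Since \<open>v \<le> k \<le> n\<close>, the natural subtraction does not
      truncate and agrees with the real one.\<close>
    with assms have "real n - real v + 1 = real (n + 1 - v)"
      by auto
    then show "deformed_number R p q (real n - real v + 1) =
        deformed_number R p q (real (n + 1 - v))"
      by (rule arg_cong)
  qed simp
  then show ?thesis
    by (simp add: deformed_binomial_def deformed_fact_def seq_binomial_def)
qed

theorem theorem3p17:
  fixes R :: "complex \<times> complex \<Rightarrow> complex" and D :: "(complex \<times> complex) set"
    and p q \<epsilon>\<^sub>1 \<epsilon>\<^sub>2 x :: real and n :: nat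
  assumes "0 < q" and "q < p" and "p \<le> 1"
    and "R meromorphic2_on D"
    and "\<And>u::real. (of_real (p powr u), of_real (q powr u)) \<in> D"
    and "\<epsilon>\<^sub>1 > 0" and "\<epsilon>\<^sub>2 > 0"
    and "\<And>u v::real. deformed_number R p q (u + v) =
           of_real (\<epsilon>\<^sub>1 powr v) * deformed_number R p q u +
           of_real (\<epsilon>\<^sub>2 powr u) * deformed_number R p q v"
    and "\<And>k::nat. k \<ge> 1 \<Longrightarrow> deformed_number R p q (real k) \<noteq> 0"
    and "n \<ge> 1"
  shows "(\<Prod>r=1..n. of_real (\<epsilon>\<^sub>1 ^ (r - 1) + x * \<epsilon>\<^sub>2 ^ (r - 1))) =
         (\<Sum>\<kappa>=0..n. of_real (\<epsilon>\<^sub>1 ^ ((n - \<kappa>) choose 2)) * of_real (\<epsilon>\<^sub>2 ^ (\<kappa> choose 2)) *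
                   deformed_binomial R p q (real n) \<kappa> * of_real (x ^ \<kappa>))"
proof -
  interpret deformed_sequence "\<lambda>m. deformed_number R p q (real m)"
    "complex_of_real \<epsilon>\<^sub>1" "complex_of_real \<epsilon>\<^sub>2"
  proof
    show "deformed_number R p q (real (i + j)) =
        complex_of_real \<epsilon>\<^sub>1 ^ j * deformed_number R p q (real i) +
        complex_of_real \<epsilon>\<^sub>2 ^ i * deformed_number R p q (real j)" for i j
      \<comment> \<open>Positivity of both bases lets \<open>powr_realpow\<close> turn
        \<open>powr\<close> at a natural exponent into a power.\<close>
      using assms(8)[of "real i" "real j"] assms(6,7) by (simp add: powr_realpow)
  qed (rule assms(9))
  show ?thesis
    using prod_eq_sum_seq_binomial[where n = n and x = "complex_of_real x"]
    by (simp add: deformed_binomial_of_nat)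
qed

end
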